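(* Let $f:\operatorname{dom} f\subseteq\mathbb{R}^n\to\mathbb{R}$ be $\mathcal{C}^3$ on $B_n(x^0;\overline{\Delta})$, where $x^0\in\operatorname{dom} f$ is the point of interest and $\overline{\Delta}>0$. Denote by $L_{\nabla^2 f}\ge0$ the Lipschitz constant of $\nabla^2 f$ on $\overline{B}_n(x^0;\overline{\Delta})$. Let $v$ be a non-zero vector in $\mathbb{R}^n$. Let $S=\begin{bmatrix}s^1&s^2&\cdots&s^m\end{bmatrix}\in\mathbb{R}^{n\times m}$ and $\overline{T}=hv$, where $h\ne0$. Assume that $B_n(x^0;\Delta_{\overline{T}})\subset B_n(x^0;\overline{\Delta})$ and $B_n(x^0+s^j;\Delta_{\overline{T}})\subset B_n(x^0;\overline{\Delta})$ for all $j\in\{1,\dots,m\}$. Then $$\left\|\operatorname{P}_S\big(\nabla_s^2 f(x^0;S,\overline{T})v\big)-\operatorname{P}_S\big(\nabla^2 f(x^0)v\big)\right\|=\left\|\nabla_s^2 f(x^0;S,\overline{T})v-\operatorname{P}_S\big(\nabla^2 f(x^0)v\big)\right\|\le 4\sqrt{m}\,L_{\nabla^2 f}\,\frac{\Delta_u}{\Delta_l}\,\|(\widehat{S}^\top)^\dagger\|\,\|v\|\,\Delta_u.$$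
   Context: $\|\cdot\|$ is the Euclidean norm on vectors and the induced (spectral) norm on matrices. $B_n(x;\Delta)$ and $\overline{B}_n(x;\Delta)$ are the open and closed balls in $\mathbb{R}^n$ centered at $x$ of radius $\Delta$. $A^\dagger$ is the Moore-Penrose pseudoinverse of a real matrix $A$ (vectors in $\mathbb{R}^n$ are $n\times1$ matrices). $\oplus$ is the Minkowski sum; a matrix is identified with the set of its columns. Generalized simplex gradient: for a matrix $T=\begin{bmatrix}t^1&\cdots&t^k\end{bmatrix}\in\mathbb{R}^{n\times k}$ and a point $x$ with $x\in\operatorname{dom} f$ and $x\oplus T\subset\operatorname{dom} f$, $\nabla_s f(x;T)=(T^\top)^\dagger\,\delta_s f(x;T)\in\mathbb{R}^n$, where $\delta_s f(x;T)=\big(f(x+t^1)-f(x),\dots,f(x+t^k)-f(x)\big)^\top\in\mathbb{R}^k$. Generalized simplex Hessian (with the same matrix $\overline{T}$ used for every column of $S$): for $S=\begin{bmatrix}s^1&\cdots&s^m\end{bmatrix}\in\mathbb{R}^{n\times m}$ and $\overline{T}\in\mathbb{R}^{n\times k}$ such that $x^0\oplus\overline{T}$, $x^0\oplus S$, $x^0+s^j\oplus\overline{T}$ are contained in $\operatorname{dom} f$ for all $j$, $\nabla_s^2 f(x^0;S,\overline{T})=(S^\top)^\dagger\,\delta_s^2 f(x^0;S,\overline{T})\in\mathbb{R}^{n\times n}$, where $\delta_s^2 f(x^0;S,\overline{T})\in\mathbb{R}^{m\times n}$ is the matrix whose $j$-th row is $\big(\nabla_s f(x^0+s^j;\overline{T})-\nabla_s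 f(x^0;\overline{T})\big)^\top$. (Here $k=1$ and $\overline{T}=hv$.) Projection of a vector: for $w\in\mathbb{R}^n$, $\operatorname{P}_S w=(S^\top)^\dagger S^\top w$. Radii and normalized matrix: $\Delta_S=\max_j\|s^j\|$; $\Delta_{\overline{T}}=\|hv\|$; $\widehat{S}=S/\Delta_S$; $\Delta_u=\max\{\Delta_S,\Delta_{\overline{T}}\}$; $\Delta_l=\min\{\Delta_S,\Delta_{\overline{T}}\}$. Standing assumptions: all points required by these definitions lie in $\operatorname{dom} f$; $S$ is non-empty with non-null rank. *)

theory Defs
  imports "HOL-Analysis.Analysis"
begin

text \<open>A real matrix with r rows and c columns has type \<open>real^'c^'r\<close>.  The library norm on
  that type is the Frobenius norm, so the induced norm is introduced separately.\<close>

definition spectral_norm :: "real^'c^'r \<Rightarrow> real" where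
  "spectral_norm A = onorm ((*v) A)"

definition is_pinv :: "real^'c^'r \<Rightarrow> real^'r^'c \<Rightarrow> bool" where
  "is_pinv A X \<longleftrightarrow> A ** X ** A = A \<and> X ** A ** X = X \<and>
     transpose (A ** X) = A ** X \<and> transpose (X ** A) = X ** A"

definition pinv :: "real^'c^'r \<Rightarrow> real^'r^'c" where
  "pinv A = (THE X. is_pinv A X)"

text \<open>A function on \<open>D \<subseteq> \<real>\<^sup>n\<close> is represented by a total function together with \<open>D\<close>;
  its derivatives are taken along \<open>D\<close>.  At interior points of \<open>D\<close> these are the ordinary
  gradient and Hessian.\<close>

definition gradient :: "(real^'n) set \<Rightarrow> (real^'n \<Rightarrow> real) \<Rightarrow> real^'n \<Rightarrow> real^'n" where
  "gradient D f x = (\<chi> i. frechet_derivative f (at x within D) (axis i 1))"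

definition hessian :: "(real^'n) set \<Rightarrow> (real^'n \<Rightarrow> real) \<Rightarrow> real^'n \<Rightarrow> real^'n^'n" where
  "hessian D f x = jacobian (gradient D f) (at x within D)"

text \<open>Class \<open>C\<^sup>k\<close> on an open set \<open>U\<close>.  In finite dimension, continuity of the iterated
  derivative in every tuple of fixed directions is continuity of the derivative itself.\<close>

primrec Ck_on ::
    "nat \<Rightarrow> ('a::euclidean_space \<Rightarrow> 'b::real_normed_vector) \<Rightarrow> 'a set \<Rightarrow> bool" where
  "Ck_on 0 f U \<longleftrightarrow> continuous_on U f"
| "Ck_on (Suc k) f U \<longleftrightarrow> (\<forall>x\<in>U. f differentiable (at x)) \<and>
     (\<forall>u. Ck_on k (\<lambda>x. frechet_derivative f (at x) u) U)"

definition delta_s :: "(real^'n \<Rightarrow> real) \<Rightarrow> real^'n \<Rightarrow> real^'k^'n \<Rightarrow> real^'k" where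
  "delta_s f x T = (\<chi> j. f (x + column j T) - f x)"

definition simplex_gradient :: "(real^'n \<Rightarrow> real) \<Rightarrow> real^'n \<Rightarrow> real^'k^'n \<Rightarrow> real^'n" where
  "simplex_gradient f x T = pinv (transpose T) *v delta_s f x T"

definition delta2_s ::
    "(real^'n \<Rightarrow> real) \<Rightarrow> real^'n \<Rightarrow> real^'m^'n \<Rightarrow> real^'k^'n \<Rightarrow> real^'n^'m" where
  "delta2_s f x S T =
     (\<chi> j. simplex_gradient f (x + column j S) T - simplex_gradient f x T)"

definition simplex_hessian ::
    "(real^'n \<Rightarrow> real) \<Rightarrow> real^'n \<Rightarrow> real^'m^'n \<Rightarrow> real^'k^'n \<Rightarrow> real^'n^'n" where
  "simplex_hessian f x S T = pinv (transpose S) ** delta2_s f x S T"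

definition proj :: "real^'m^'n \<Rightarrow> real^'n \<Rightarrow> real^'n" where
  "proj S w = (pinv (transpose S) ** transpose S) *v w"

definition radius :: "real^'m^'n \<Rightarrow> real" where
  "radius S = Max (range (\<lambda>j. norm (column j S)))"

definition normalized :: "real^'m^'n \<Rightarrow> real^'m^'n" where
  "normalized S = (1 / radius S) *\<^sub>R S"

end

theory Submission
  imports Defs
begin

text \<open>
  The error vector is \<open>(S\<^sup>T)\<^sup>\<dagger>\<close> applied to the vector whose \<open>j\<close>-th entry is \<open>1/h\<close> times the second
  difference \<open>f (x0 + s + t) - f (x0 + s) - f (x0 + t) + f x0\<close> minus \<open>s \<bullet> H t\<close>, where \<open>s = s\<^sup>j\<close>,
  \<open>t = h v\<close> and \<open>H\<close> is the Hessian at \<open>x0\<close>.  The parallelogram spanned by \<open>s\<close> and \<open>t\<close> at \<open>x0\<close> lies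
  in the closed ball by convexity.  Applying the mean value theorem first along \<open>s\<close> and then to the
  gradient along \<open>t\<close> turns that entry into \<open>s \<bullet> (H' - H) t\<close>, with \<open>H'\<close> the Hessian at a point of the
  parallelogram.  Differentiating in this order produces \<open>s \<bullet> H t\<close> itself and not its
  symmetrisation.
\<close>

section \<open>The Moore-Penrose inverse\<close>

text \<open>\<open>A ** X\<close> and \<open>A ** Y\<close> are both the orthogonal projection onto
  the range of \<open>A\<close>, and \<open>X ** A\<close> and \<open>Y ** A\<close> both project
  onto its row space. Once each pair agrees, \<open>X = X A X = Y A X = Y A Y = Y\<close>.\<close>

lemma is_pinv_unique:
  fixes A :: "real^'c^'r"
  assumes "is_pinv A X" "is_pinv A Y"
  shows "X = Y"
proof -
  have AX: "A ** X ** A = A" "X ** A ** X = X" "transpose (A ** X) = A ** X"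
      "transpose (X ** A) = X ** A"
    and AY: "A ** Y ** A = A" "Y ** A ** Y = Y" "transpose (A ** Y) = A ** Y"
      "transpose (Y ** A) = Y ** A"
    using assms by (auto simp: is_pinv_def)
  have "A ** X = (A ** Y) ** (A ** X)"
    by (metis AY(1) matrix_mul_assoc)
  \<comment> \<open>Both factors are symmetric, so transposing their product swaps them.\<close>
  also have "\<dots> = transpose ((A ** X) ** (A ** Y))"
    by (simp only: matrix_transpose_mul[of "A ** X" "A ** Y"] AX AY)
  also have "\<dots> = A ** Y"
    by (metis AX(1) AY(3) matrix_mul_assoc)
  finally have 1: "A ** X = A ** Y" .
  have "X ** A = (X ** A) ** (Y ** A)"
    by (metis AY(1) matrix_mul_assoc)
  also have "\<dots> = transpose ((Y ** A) ** (X ** A))"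
    by (simp only: matrix_transpose_mul[of "Y ** A" "X ** A"] AX AY)
  also have "\<dots> = Y ** A"
    by (metis AX(1) AY(4) matrix_mul_assoc)
  finally have 2: "X ** A = Y ** A" .
  show ?thesis
    by (metis 1 2 AX(2) AY(2) matrix_mul_assoc)
qed

text \<open>\<open>X y\<close> is the least squares solution of \<open>A x = y\<close> orthogonal to the kernel of \<open>A\<close>.\<close>

lemma is_pinv_exists:
  fixes A :: "real^'c^'r"
  shows "\<exists>X. is_pinv A X"
proof -
  define K where "K = {x. A *v x = 0}"
  \<comment> \<open>These are the normal equations, with \<open>x\<close> restricted to the
    orthogonal complement of the kernel.\<close>
  define Q where "Q y x \<longleftrightarrow> (\<forall>k\<in>K. x \<bullet> k = 0) \<and> (\<forall>z. (y - A *v x) \<bullet> (A *v z) = 0)" for y x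
  have subK: "subspace K"
    by (auto simp: K_def subspace_def matrix_vector_right_distrib matrix_vector_mult_scaleR)
  have ex: "\<exists>x. Q y x" for y
  proof -
    have "subspace (range ((*v) A))"
      by (intro linear_subspace_image matrix_vector_mul_linear subspace_UNIV)
    then obtain u w where u: "u \<in> range ((*v) A)" and w: "\<And>z. z \<in> range ((*v) A) \<Longrightarrow> orthogonal w z"
      and y: "y = u + w"
      by (metis orthogonal_subspace_decomp_exists span_eq_iff)
    obtain x' where x': "u = A *v x'" using u by blast
    obtain k x where k: "k \<in> K" and x: "\<And>z. z \<in> K \<Longrightarrow> orthogonal x z" and xk: "x' = k + x"
      using subK by (metis orthogonal_subspace_decomp_exists span_eq_iff)
    have "A *v x' = A *v x"
      using k by (simp add: xk K_def matrix_vector_right_distrib)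
    then have "Q y x"
      using x w by (auto simp: Q_def orthogonal_def y x')
    then show ?thesis ..
  qed
  \<comment> \<open>The difference of the two residuals lies in the range of \<open>A\<close> and is
    orthogonal to it, hence vanishes. So \<open>x - x'\<close> lies in \<open>K\<close> and is
    orthogonal to \<open>K\<close>.\<close>
  have uniq: "x = x'" if "Q y x" "Q y x'" for y x x'
  proof -
    have "A *v (x - x') = (y - A *v x') - (y - A *v x)"
      by (simp add: matrix_vector_mult_diff_distrib)
    then have "(A *v (x - x')) \<bullet> (A *v (x - x')) = 0"
      using that by (metis Q_def diff_zero inner_diff_left)
    then have "x - x' \<in> K" by (simp add: K_def)
    then have "(x - x') \<bullet> (x - x') = 0"
      using that by (metis Q_def diff_zero inner_diff_left)
    then show ?thesis by simp
  qed
  define F where "F y = (SOME x. Q y x)" for y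
  have QF: "Q y (F y)" for y
    unfolding F_def using ex by (rule someI_ex)
  \<comment> \<open>The conditions in \<open>Q\<close> are linear in \<open>y\<close> and
    \<open>x\<close> jointly, so uniqueness makes the chosen solution linear in
    \<open>y\<close>.\<close>
  have "linear F"
  proof (rule linearI)
    show "F (y + z) = F y + F z" for y z
      by (rule uniq[OF QF]) (use QF[of y] QF[of z] in
          \<open>auto simp: Q_def matrix_vector_right_distrib inner_diff_left inner_add_left\<close>)
    show "F (r *\<^sub>R y) = r *\<^sub>R F y" for r y
      by (rule uniq[OF QF]) (use QF[of y] in
          \<open>auto simp: Q_def matrix_vector_mult_scaleR inner_diff_left\<close>)
  qed
  then have XF: "matrix F *v y = F y" for y
    by (simp add: matrix_works)
  have AFA: "A *v F (A *v x) = A *v x" for x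
  proof -
    have "(A *v x - A *v F (A *v x)) \<bullet> (A *v (x - F (A *v x))) = 0"
      using QF[of "A *v x"] by (simp add: Q_def)
    then show ?thesis by (simp add: matrix_vector_mult_diff_distrib)
  qed
  have FAF: "F (A *v F y) = F y" for y
  proof (rule uniq[OF QF])
    show "Q (A *v F y) (F y)" using QF[of y] by (simp add: Q_def)
  qed
  have symI: "transpose M = M" if "\<And>x y. (M *v x) \<bullet> y = x \<bullet> (M *v y)" for M :: "real^'k^'k"
    by (metis that adjoint_matrix adjoint_unique matrix_of_matrix_vector_mul matrix_vector_mul_linear)
  \<comment> \<open>Orthogonality of the residuals makes both sides equal to
    \<open>(A *v F x) \<bullet> (A *v F y)\<close>.\<close>
  have "(A *v F x) \<bullet> y = x \<bullet> (A *v F y)" for x y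
  proof -
    have "(y - A *v F y) \<bullet> (A *v F x) = 0" "(x - A *v F x) \<bullet> (A *v F y) = 0"
      using QF[of x] QF[of y] by (simp_all add: Q_def)
    then show ?thesis by (simp add: inner_diff_left inner_diff_right inner_commute)
  qed
  then have s1: "transpose (A ** matrix F) = A ** matrix F"
    by (intro symI) (simp add: XF flip: matrix_vector_mul_assoc)
  \<comment> \<open>Values of \<open>F\<close> are orthogonal to \<open>K\<close>, so both sides
    equal \<open>F (A *v x) \<bullet> F (A *v y)\<close>.\<close>
  have "F (A *v x) \<bullet> y = x \<bullet> F (A *v y)" for x y
  proof -
    have "x - F (A *v x) \<in> K" "y - F (A *v y) \<in> K"
      by (simp_all add: K_def matrix_vector_mult_diff_distrib AFA)
    then have "F (A *v x) \<bullet> (y - F (A *v y)) = 0" "F (A *v y) \<bullet> (x - F (A *v x)) = 0"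
      using QF by (auto simp: Q_def)
    then show ?thesis by (simp add: inner_diff_right inner_commute)
  qed
  then have s2: "transpose (matrix F ** A) = matrix F ** A"
    by (intro symI) (simp add: XF flip: matrix_vector_mul_assoc)
  have "is_pinv A (matrix F)"
    unfolding is_pinv_def
    using s1 s2 by (auto simp: matrix_eq XF AFA FAF simp flip: matrix_vector_mul_assoc)
  then show ?thesis ..
qed

lemma pinv_eqI: "is_pinv A X \<Longrightarrow> pinv A = X"
  unfolding pinv_def by (blast intro: the_equality is_pinv_unique)

lemma is_pinv_pinv: "is_pinv A (pinv A)"
  using is_pinv_exists pinv_eqI by metis

lemma pinv_scaleR:
  fixes A :: "real^'c^'r"
  assumes "c \<noteq> 0"
  shows "pinv (c *\<^sub>R A) = (1 / c) *\<^sub>R pinv A"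
  by (rule pinv_eqI) (use is_pinv_pinv[of A] assms in
      \<open>simp add: is_pinv_def matrix_scalar_ac transpose_scalar flip: scalar_matrix_assoc\<close>)

text \<open>The Gram matrix of a single column is the 1 by 1 matrix \<open>w \<bullet> w\<close>, so
  the Penrose equations reduce to cancelling a nonzero scalar.\<close>

lemma pinv_transpose_columnvector:
  fixes w :: "real^'n"
  assumes "w \<noteq> 0"
  shows "pinv (transpose (columnvector w :: real^1^'n)) = (1 / (w \<bullet> w)) *\<^sub>R columnvector w"
proof (rule pinv_eqI)
  let ?W = "columnvector w :: real^1^'n"
  have W: "transpose ?W ** ?W = mat (w \<bullet> w)"
    by (simp add: vec_eq_iff matrix_matrix_mult_def transpose_def columnvector_def mat_def
        inner_vec_def forall_1)
  have m: "mat c ** (B :: real^'k^1) = c *\<^sub>R B" for c and B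
    by (simp add: vec_eq_iff matrix_matrix_mult_def mat_def forall_1 sum_1)
  have m': "(B :: real^1^'k) ** mat c = c *\<^sub>R B" for c and B
    by (simp add: vec_eq_iff matrix_matrix_mult_def mat_def forall_1 sum_1 mult.commute)
  have "transpose ?W ** ?W ** transpose ?W = (w \<bullet> w) *\<^sub>R transpose ?W"
    by (simp only: W m)
  moreover have "?W ** transpose ?W ** ?W = (w \<bullet> w) *\<^sub>R ?W"
    by (simp only: W m' flip: matrix_mul_assoc)
  ultimately show "is_pinv (transpose ?W) ((1 / (w \<bullet> w)) *\<^sub>R ?W)"
    using assms
    by (simp add: is_pinv_def matrix_scalar_ac transpose_scalar matrix_transpose_mul
        flip: scalar_matrix_assoc)
qed

text \<open>An instance of \<open>X A X = X\<close>. It gives the equality of the two norms in the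
  theorem, since the simplex Hessian has \<open>pinv (transpose S)\<close> as its left
  factor.\<close>

lemma proj_pinv_mult:
  fixes S :: "real^'m^'n"
  shows "proj S (pinv (transpose S) *v w) = pinv (transpose S) *v w"
  using is_pinv_pinv[of "transpose S"]
  by (simp add: proj_def is_pinv_def matrix_vector_mul_assoc)

section \<open>Second differences\<close>

text \<open>Derivatives relative to \<open>C\<close> suffice because every segment used stays in
  \<open>C\<close>; corners on the boundary of a closed ball are therefore allowed.\<close>

lemma second_difference_mvt:
  fixes f :: "'a::real_inner \<Rightarrow> real" and g :: "'a \<Rightarrow> 'a"
  assumes C: "convex C" "x \<in> C" "x + s \<in> C" "x + t \<in> C" "x + s + t \<in> C"
    and f: "\<And>y. y \<in> C \<Longrightarrow> (f has_derivative (\<lambda>w. g y \<bullet> w)) (at y within C)"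
    and g: "\<And>y. y \<in> C \<Longrightarrow> (g has_derivative H y) (at y within C)"
  shows "\<exists>a\<in>{0..1}. \<exists>b\<in>{0..1}. x + a *\<^sub>R s + b *\<^sub>R t \<in> C \<and>
    f (x + s + t) - f (x + s) - f (x + t) + f x = s \<bullet> H (x + a *\<^sub>R s + b *\<^sub>R t) t"
proof -
  \<comment> \<open>Two successive convex combinations of the four corners reach every point of the
    parallelogram.\<close>
  have inC: "x + a *\<^sub>R s + b *\<^sub>R t \<in> C" if "a \<in> {0..1}" "b \<in> {0..1}" for a b
  proof -
    have "(1 - a) *\<^sub>R x + a *\<^sub>R (x + s) \<in> C" "(1 - a) *\<^sub>R (x + t) + a *\<^sub>R (x + s + t) \<in> C"
      using C that by (auto intro!: convexD)
    then have "(1 - b) *\<^sub>R ((1 - a) *\<^sub>R x + a *\<^sub>R (x + s)) +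
        b *\<^sub>R ((1 - a) *\<^sub>R (x + t) + a *\<^sub>R (x + s + t)) \<in> C"
      using C(1) that by (auto intro!: convexD)
    then show ?thesis by (simp add: algebra_simps)
  qed
  have line: "((\<lambda>a. y + a *\<^sub>R z) has_derivative (\<lambda>d. d *\<^sub>R z)) (at a within B)"
    for y z :: 'a and a :: real and B
    by (auto intro!: derivative_eq_intros)
  have der_f: "((\<lambda>a. f (x + b *\<^sub>R t + a *\<^sub>R s)) has_derivative
      (\<lambda>d. g (x + b *\<^sub>R t + a *\<^sub>R s) \<bullet> d *\<^sub>R s)) (at a within {0..1})"
    if "a \<in> {0..1}" "b \<in> {0..1}" for a b
    by (rule has_derivative_in_compose2[OF f _ _ line])
       (use that inC in \<open>auto simp: algebra_simps\<close>)
  have der_g: "((\<lambda>b. g (x + a *\<^sub>R s + b *\<^sub>R t)) has_derivative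
      (\<lambda>d. H (x + a *\<^sub>R s + b *\<^sub>R t) (d *\<^sub>R t))) (at b within {0..1})"
    if "a \<in> {0..1}" "b \<in> {0..1}" for a b
    by (rule has_derivative_in_compose2[OF g _ _ line]) (use that inC in auto)
  \<comment> \<open>The function is the increment of \<open>f\<close> along \<open>t\<close>, viewed
    along \<open>s\<close>. The scalars 1 and 0 keep both terms in the form of
    \<open>der_f\<close>.\<close>
  obtain a where a: "a \<in> {0<..<1}" and
    "(f (x + 1 *\<^sub>R t + 1 *\<^sub>R s) - f (x + 0 *\<^sub>R t + 1 *\<^sub>R s)) -
       (f (x + 1 *\<^sub>R t + 0 *\<^sub>R s) - f (x + 0 *\<^sub>R t + 0 *\<^sub>R s)) =
     g (x + 1 *\<^sub>R t + a *\<^sub>R s) \<bullet> (1 - 0) *\<^sub>R s - g (x + 0 *\<^sub>R t + a *\<^sub>R s) \<bullet> (1 - 0) *\<^sub>R s"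
    using mvt_simple[of 0 1
        "\<lambda>a. f (x + 1 *\<^sub>R t + a *\<^sub>R s) - f (x + 0 *\<^sub>R t + a *\<^sub>R s)"
        "\<lambda>a d. g (x + 1 *\<^sub>R t + a *\<^sub>R s) \<bullet> d *\<^sub>R s - g (x + 0 *\<^sub>R t + a *\<^sub>R s) \<bullet> d *\<^sub>R s"]
      has_derivative_diff[OF der_f[where b = 1] der_f[where b = 0]] by auto
  then have 1: "f (x + s + t) - f (x + s) - f (x + t) + f x =
      s \<bullet> g (x + a *\<^sub>R s + 1 *\<^sub>R t) - s \<bullet> g (x + a *\<^sub>R s + 0 *\<^sub>R t)"
    by (simp add: algebra_simps inner_commute)
  obtain b where b: "b \<in> {0<..<1}" and
    "s \<bullet> g (x + a *\<^sub>R s + 1 *\<^sub>R t) - s \<bullet> g (x + a *\<^sub>R s + 0 *\<^sub>R t) =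
      s \<bullet> H (x + a *\<^sub>R s + b *\<^sub>R t) ((1 - 0) *\<^sub>R t)"
    using mvt_simple[of 0 1 "\<lambda>b. s \<bullet> g (x + a *\<^sub>R s + b *\<^sub>R t)"
        "\<lambda>b d. s \<bullet> H (x + a *\<^sub>R s + b *\<^sub>R t) (d *\<^sub>R t)"]
      has_derivative_inner_right[OF der_g, of a] a by auto
  with 1 a b show ?thesis
    by (intro bexI[of _ a] bexI[of _ b] conjI inC) auto
qed

lemma second_difference_bound:
  fixes f :: "'a::real_inner \<Rightarrow> real" and g :: "'a \<Rightarrow> 'a"
  assumes C: "convex C" "x \<in> C" "x + s \<in> C" "x + t \<in> C" "x + s + t \<in> C"
    and f: "\<And>y. y \<in> C \<Longrightarrow> (f has_derivative (\<lambda>w. g y \<bullet> w)) (at y within C)"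
    and g: "\<And>y. y \<in> C \<Longrightarrow> (g has_derivative H y) (at y within C)"
    and lip: "\<And>y. y \<in> C \<Longrightarrow> norm (H y t - H x t) \<le> L * norm (y - x) * norm t"
    and "L \<ge> 0"
  shows "\<bar>f (x + s + t) - f (x + s) - f (x + t) + f x - s \<bullet> H x t\<bar>
    \<le> L * (norm s + norm t) * norm s * norm t"
proof -
  obtain a b where ab: "a \<in> {0..1}" "b \<in> {0..1}" and y: "x + a *\<^sub>R s + b *\<^sub>R t \<in> C"
    and eq: "f (x + s + t) - f (x + s) - f (x + t) + f x = s \<bullet> H (x + a *\<^sub>R s + b *\<^sub>R t) t"
    using second_difference_mvt[OF C f g] by blast
  let ?y = "x + a *\<^sub>R s + b *\<^sub>R t"
  have "norm (?y - x) \<le> norm (a *\<^sub>R s) + norm (b *\<^sub>R t)"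
    by (metis add.assoc add_diff_cancel_left' norm_triangle_ineq)
  also have "\<dots> \<le> norm s + norm t"
    using ab by (intro add_mono) (auto intro: mult_left_le_one_le)
  finally have d: "norm (?y - x) \<le> norm s + norm t" .
  have "\<bar>s \<bullet> (H ?y t - H x t)\<bar> \<le> norm s * norm (H ?y t - H x t)"
    by (rule Cauchy_Schwarz_ineq2)
  also have "\<dots> \<le> norm s * (L * norm (?y - x) * norm t)"
    by (intro mult_left_mono lip y) auto
  also have "\<dots> \<le> norm s * (L * (norm s + norm t) * norm t)"
    using d \<open>L \<ge> 0\<close> by (intro mult_left_mono mult_right_mono) auto
  finally show ?thesis
    by (simp add: eq inner_diff_right mult_ac)
qed

section \<open>Gradients, norms and radii\<close>

text \<open>A derivative within \<open>D\<close> may fail to be unique, but \<open>gradient\<close>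
  takes its coordinates from the same \<open>frechet_derivative\<close>, and linearity recovers that
  map from its values on the axes.\<close>

lemma has_derivative_gradient:
  fixes f :: "real^'n \<Rightarrow> real"
  assumes "f differentiable (at x within D)"
  shows "(f has_derivative (\<lambda>w. gradient D f x \<bullet> w)) (at x within D)"
proof -
  let ?f' = "frechet_derivative f (at x within D)"
  have f': "(f has_derivative ?f') (at x within D)"
    using assms by (simp add: frechet_derivative_works)
  have "?f' w = gradient D f x \<bullet> w" for w
  proof -
    have "?f' w = ?f' (\<Sum>i\<in>UNIV. w $ i *\<^sub>R axis i 1)"
      by (simp add: basis_expansion flip: scalar_mult_eq_scaleR)
    also have "\<dots> = (\<Sum>i\<in>UNIV. w $ i *\<^sub>R ?f' (axis i 1))"
      using has_derivative_linear[OF f'] by (simp add: linear_sum linear_cmul)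
    finally show ?thesis
      by (simp add: gradient_def inner_vec_def mult.commute)
  qed
  then have "?f' = (\<lambda>w. gradient D f x \<bullet> w)" by blast
  with f' show ?thesis by simp
qed

lemma has_derivative_hessian:
  fixes f :: "real^'n \<Rightarrow> real"
  assumes "gradient D f differentiable (at x within D)"
  shows "(gradient D f has_derivative (\<lambda>w. hessian D f x *v w)) (at x within D)"
  using assms by (simp add: hessian_def jacobian_works)

lemma norm_matrix_vector_le_spectral_norm: "norm (A *v x) \<le> spectral_norm A * norm x"
  unfolding spectral_norm_def by (rule onorm[OF matrix_vector_mul_bounded_linear])

lemma spectral_norm_nonneg: "0 \<le> spectral_norm A"
  unfolding spectral_norm_def by (rule onorm_pos_le[OF matrix_vector_mul_bounded_linear])

text \<open>Source of the factor \<open>sqrt m\<close> in the error bound.\<close>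

lemma norm_le_sqrt_card:
  fixes d :: "real^'m"
  assumes "\<And>j. \<bar>d $ j\<bar> \<le> B"
  shows "norm d \<le> sqrt (real CARD('m)) * B"
proof -
  have "0 \<le> B" using assms by (meson abs_ge_zero order_trans)
  have "(\<Sum>j\<in>UNIV. (norm (d $ j))\<^sup>2) \<le> (\<Sum>j\<in>(UNIV :: 'm set). B\<^sup>2)"
    using assms by (intro sum_mono power_mono) auto
  then have "norm d \<le> sqrt (real CARD('m) * B\<^sup>2)"
    unfolding norm_vec_def L2_set_def by (intro real_sqrt_le_mono) simp
  with \<open>0 \<le> B\<close> show ?thesis by (simp add: real_sqrt_mult)
qed

lemma norm_column_le_radius: "norm (column j S) \<le> radius S"
  unfolding radius_def by (rule Max_ge) auto

lemma radius_pos: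
  assumes "S \<noteq> 0"
  shows "0 < radius S"
proof -
  obtain i j where "S $ i $ j \<noteq> 0"
    using assms by (metis vec_eq_iff zero_index)
  then have "column j S \<noteq> 0"
    by (auto simp: column_def vec_eq_iff)
  then show ?thesis
    using norm_column_le_radius[of j S] by (smt (verit) zero_less_norm_iff)
qed

lemma column_columnvector: "column i (columnvector w :: real^1^'n) = w"
  by (simp add: column_def columnvector_def vec_eq_iff)

lemma radius_columnvector: "radius (columnvector w :: real^1^'n) = norm w"
  by (simp add: radius_def column_columnvector image_constant_conv)

lemma pinv_transpose_normalized:
  fixes S :: "real^'m^'n"
  assumes "S \<noteq> 0"
  shows "pinv (transpose S) = (1 / radius S) *\<^sub>R pinv (transpose (normalized S))"
proof -
  have "transpose S = radius S *\<^sub>R transpose (normalized S)"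
    using radius_pos[OF assms] by (simp add: normalized_def transpose_scalar)
  then show ?thesis
    using pinv_scaleR radius_pos[OF assms] by (metis less_irrefl)
qed

lemma simplex_gradient_columnvector:
  fixes w :: "real^'n"
  assumes "w \<noteq> 0"
  shows "simplex_gradient f x (columnvector w :: real^1^'n) = ((f (x + w) - f x) / (w \<bullet> w)) *\<^sub>R w"
  unfolding simplex_gradient_def pinv_transpose_columnvector[OF assms] delta_s_def
    column_columnvector
  by (simp add: vec_eq_iff matrix_vector_mult_def columnvector_def sum_1)

text \<open>Points on the bounding sphere need not be interior to \<open>domf\<close>, so
  differentiability on the closed ball is expressed along \<open>domf\<close>.\<close>

theorem theorem20:
  fixes f :: "real^'n \<Rightarrow> real" and domf :: "(real^'n) set"
    and x0 v :: "real^'n" and S :: "real^'m^'n" and T :: "real^1^'n"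
    and h \<Delta> L :: real
  assumes "\<Delta> > 0"
    and "v \<noteq> 0" and "h \<noteq> 0"
    and T: "T = columnvector (h *\<^sub>R v)"
    and rank: "rank S \<noteq> 0"
    and "x0 \<in> domf"
    and "\<And>i. x0 + column i T \<in> domf"
    and "\<And>j. x0 + column j S \<in> domf"
    and "\<And>j i. x0 + column j S + column i T \<in> domf"
    and cball_dom: "cball x0 \<Delta> \<subseteq> domf"
    and C3: "Ck_on 3 f (ball x0 \<Delta>)"
    and grad_exists: "\<And>x. x \<in> cball x0 \<Delta> \<Longrightarrow> f differentiable (at x within domf)"
    and hess_exists: "\<And>x. x \<in> cball x0 \<Delta> \<Longrightarrow> gradient domf f differentiable (at x within domf)"
    and "L \<ge> 0"
    and hess_lipschitz: "\<And>x y. x \<in> cball x0 \<Delta> \<Longrightarrow> y \<in> cball x0 \<Delta> \<Longrightarrow>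
           spectral_norm (hessian domf f x - hessian domf f y) \<le> L * norm (x - y)"
    and "ball x0 (radius T) \<subseteq> ball x0 \<Delta>"
    and "\<And>j. ball (x0 + column j S) (radius T) \<subseteq> ball x0 \<Delta>"
  shows "norm (proj S (simplex_hessian f x0 S T *v v) - proj S (hessian domf f x0 *v v))
           = norm (simplex_hessian f x0 S T *v v - proj S (hessian domf f x0 *v v))
       \<and> norm (simplex_hessian f x0 S T *v v - proj S (hessian domf f x0 *v v))
           \<le> 4 * sqrt (real CARD('m)) * L
               * (max (radius S) (radius T) / min (radius S) (radius T))
               * spectral_norm (pinv (transpose (normalized S)))
               * norm v * max (radius S) (radius T)"
proof -
  define t where "t = h *\<^sub>R v"
  define H where "H = hessian domf f x0"
  define P where "P = pinv (transpose S)"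
  have "t \<noteq> 0" using \<open>v \<noteq> 0\<close> \<open>h \<noteq> 0\<close> by (simp add: t_def)
  have T': "T = columnvector t" by (simp add: T t_def)
  have rT: "radius T = norm t" by (simp add: T' radius_columnvector)
  have "S \<noteq> 0" using rank by auto
  define a where "a = radius S"
  define b where "b = norm t"
  have ab: "a > 0" "b > 0"
    using radius_pos[OF \<open>S \<noteq> 0\<close>] \<open>t \<noteq> 0\<close> by (auto simp: a_def b_def)
  define N where "N = spectral_norm (pinv (transpose (normalized S)))"

  \<comment> \<open>Closures turn the inclusion of open balls into one of closed balls, which is
    what captures \<open>y + t\<close>, a point at distance exactly \<open>radius T\<close> from
    \<open>y\<close>. Here \<open>t \<noteq> 0\<close> matters: an open ball of radius 0 is
    empty.\<close>
  have shift: "y \<in> cball x0 \<Delta> \<and> y + t \<in> cball x0 \<Delta>" if "ball y (radius T) \<subseteq> ball x0 \<Delta>" for y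
  proof -
    have "cball y (norm t) \<subseteq> cball x0 \<Delta>"
      using closure_mono[OF that] \<open>t \<noteq> 0\<close> \<open>\<Delta> > 0\<close> by (simp add: rT)
    moreover have "y \<in> cball y (norm t)" "y + t \<in> cball y (norm t)"
      by (auto simp: dist_norm)
    ultimately show ?thesis by blast
  qed

  define e where "e = delta2_s f x0 S T *v v - transpose S *v (H *v v)"
  have entry: "e $ j = (f (x0 + column j S + t) - f (x0 + column j S) - f (x0 + t) + f x0
      - column j S \<bullet> (H *v t)) / h" for j
  proof -
    \<comment> \<open>Since \<open>t = h v\<close>, the quotient keeps the sign of \<open>h\<close>;
      the absolute value appears only in the estimate.\<close>
    have c: "c * (t \<bullet> v) / (t \<bullet> t) = c / h" for c
      using \<open>v \<noteq> 0\<close> \<open>h \<noteq> 0\<close> by (simp add: t_def field_simps)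
    have "(delta2_s f x0 S T *v v) $ j =
        (simplex_gradient f (x0 + column j S) T - simplex_gradient f x0 T) \<bullet> v"
      by (simp add: delta2_s_def matrix_vector_mul_component)
    also have "\<dots> = (f (x0 + column j S + t) - f (x0 + column j S)) / h - (f (x0 + t) - f x0) / h"
      by (simp add: T' simplex_gradient_columnvector \<open>t \<noteq> 0\<close> inner_diff_left c)
    finally have 1: "(delta2_s f x0 S T *v v) $ j = \<dots>" .
    have "(transpose S *v (H *v v)) $ j = column j S \<bullet> (H *v v)"
      by (simp add: matrix_vector_mul_component transpose_def column_def)
    also have "\<dots> = column j S \<bullet> (H *v t) / h"
      using \<open>h \<noteq> 0\<close> by (simp add: t_def matrix_vector_mult_scaleR)
    finally show ?thesis
      by (simp add: e_def 1 diff_divide_distrib add_divide_distrib)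
  qed
  have entry_bound: "\<bar>e $ j\<bar> \<le> L * (2 * max a b) * a * norm v" for j
  proof -
    let ?s = "column j S"
    have "x0 \<in> cball x0 \<Delta>" "x0 + ?s \<in> cball x0 \<Delta>" "x0 + t \<in> cball x0 \<Delta>"
      "x0 + ?s + t \<in> cball x0 \<Delta>"
      using shift assms by blast+
    \<comment> \<open>Derivatives along \<open>domf\<close> restrict to the closed ball, which
      supplies the required convexity.\<close>
    moreover have "(f has_derivative (\<lambda>w. gradient domf f y \<bullet> w)) (at y within cball x0 \<Delta>)"
      if "y \<in> cball x0 \<Delta>" for y
      using has_derivative_gradient[OF grad_exists[OF that]] cball_dom
      by (rule has_derivative_subset)
    moreover have "(gradient domf f has_derivative (\<lambda>w. hessian domf f y *v w))
        (at y within cball x0 \<Delta>)" if "y \<in> cball x0 \<Delta>" for y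
      using has_derivative_hessian[OF hess_exists[OF that]] cball_dom
      by (rule has_derivative_subset)
    moreover have "norm (hessian domf f y *v t - H *v t) \<le> L * norm (y - x0) * norm t"
      if "y \<in> cball x0 \<Delta>" for y
    proof -
      have "norm ((hessian domf f y - H) *v t) \<le> spectral_norm (hessian domf f y - H) * norm t"
        by (rule norm_matrix_vector_le_spectral_norm)
      also have "\<dots> \<le> L * norm (y - x0) * norm t"
        unfolding H_def using that \<open>\<Delta> > 0\<close> by (intro mult_right_mono hess_lipschitz) auto
      finally show ?thesis by (simp add: matrix_vector_mult_diff_rdistrib)
    qed
    ultimately have "\<bar>f (x0 + ?s + t) - f (x0 + ?s) - f (x0 + t) + f x0 - ?s \<bullet> (H *v t)\<bar>
        \<le> L * (norm ?s + norm t) * norm ?s * norm t"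
      unfolding H_def using \<open>L \<ge> 0\<close> by (intro second_difference_bound[of "cball x0 \<Delta>"]) auto
    \<comment> \<open>The 2 comes from \<open>a + b \<le> 2 * max a b\<close>. Dividing by
      \<open>\<bar>h\<bar>\<close> afterwards turns \<open>norm t\<close> into
      \<open>norm v\<close>.\<close>
    also have "\<dots> \<le> L * (2 * max a b) * a * norm t"
      using norm_column_le_radius[of j S] \<open>L \<ge> 0\<close> ab
      by (intro mult_right_mono mult_mono mult_left_mono mult_nonneg_nonneg)
         (auto simp: a_def b_def)
    finally have "\<bar>e $ j\<bar> \<le> L * (2 * max a b) * a * norm t / \<bar>h\<bar>"
      by (simp add: entry abs_divide divide_right_mono)
    then show ?thesis
      using \<open>h \<noteq> 0\<close> by (simp add: t_def)
  qed

  have sh: "simplex_hessian f x0 S T *v v = P *v (delta2_s f x0 S T *v v)"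
    by (simp add: simplex_hessian_def P_def matrix_vector_mul_assoc)
  have "proj S (H *v v) = P *v (transpose S *v (H *v v))"
    by (simp add: proj_def P_def flip: matrix_vector_mul_assoc)
  then have diff: "simplex_hessian f x0 S T *v v - proj S (H *v v) = P *v e"
    by (simp add: sh e_def matrix_vector_mult_diff_distrib)
  \<comment> \<open>Normalising \<open>S\<close> yields the divisor \<open>a\<close>, which cancels
    the factor \<open>a\<close> in \<open>entry_bound\<close>.\<close>
  have "norm (P *v e) = norm (pinv (transpose (normalized S)) *v e) / a"
    using ab by (simp add: P_def pinv_transpose_normalized[OF \<open>S \<noteq> 0\<close>] a_def
        scaleR_matrix_vector_assoc[symmetric])
  also have "\<dots> \<le> N * norm e / a"
    using ab norm_matrix_vector_le_spectral_norm by (intro divide_right_mono) (auto simp: N_def)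
  also have "\<dots> \<le> N * (sqrt (real CARD('m)) * (L * (2 * max a b) * a * norm v)) / a"
    using ab norm_le_sqrt_card[OF entry_bound] spectral_norm_nonneg
    by (intro divide_right_mono mult_left_mono) (auto simp: N_def)
  also have "\<dots> = 2 * sqrt (real CARD('m)) * L * 1 * N * norm v * max a b"
    using ab by (simp add: field_simps)
  \<comment> \<open>Here 2 is enlarged to 4, and 1 to \<open>max a b / min a b\<close>.\<close>
  also have "\<dots> \<le> 4 * sqrt (real CARD('m)) * L * (max a b / min a b) * N * norm v * max a b"
    using ab \<open>L \<ge> 0\<close> spectral_norm_nonneg
    by (intro mult_right_mono mult_mono) (auto simp: N_def field_simps)
  finally have "norm (P *v e)
      \<le> 4 * sqrt (real CARD('m)) * L * (max a b / min a b) * N * norm v * max a b" .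
  moreover have "proj S (simplex_hessian f x0 S T *v v) = simplex_hessian f x0 S T *v v"
    by (simp add: sh P_def proj_pinv_mult)
  ultimately show ?thesis
    by (simp add: diff rT flip: H_def a_def b_def N_def)
qed

end
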